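(* For any natural numbers $k$ and $p$, the class of $M(p)$-free bipartite graphs of chordality at most $k$ is at most factorial.
   Context: Graphs are finite, simple and undirected. A graph is $H$-free if it contains no induced subgraph isomorphic to $H$. A bipartite graph has chordality at most $k$ if it has no chordless (induced) cycle of length greater than $k$. $L(1,p)$ is the bipartite graph obtained from $K_{2,p}$ by adding one pendant edge to one of the two vertices of the part of size $2$ (a vertex of degree $p$ in $K_{2,p}$); let $w$ be the new vertex of degree $1$ so created. $M(p)$ is the bipartite graph obtained from $L(1,p)$ by adding one new vertex adjacent only to $w$. A hereditary class (one closed under taking induced subgraphs) is at most factorial if the number of labelled graphs in it with vertex set $\{1,\ldots,n\}$ is $2^{O(n\log n)}$. *)

theory Defs
  imports "Graph_Theory.Graph_Theory" "HOL-Library.Landau_Symbols"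
begin

text \<open>
  Finite simple undirected graphs are rendered by the locale predicate \<^const>\<open>pair_graph\<close>: finite,
  irreflexive and symmetric, so each undirected edge is a pair of opposite arcs.
\<close>

definition bipartite :: "'a pair_pre_digraph \<Rightarrow> bool" where
  "bipartite G \<longleftrightarrow>
    (\<exists>A B. pverts G = A \<union> B \<and> A \<inter> B = {} \<and> parcs G \<subseteq> A \<times> B \<union> B \<times> A)"

definition induced_free :: "'b pair_pre_digraph \<Rightarrow> 'a pair_pre_digraph \<Rightarrow> bool" where
  "induced_free H G \<longleftrightarrow>
    \<not> (\<exists>K :: 'a pair_pre_digraph.
        induced_subgraph (with_proj K) (with_proj G) \<and> digraph_iso (with_proj K) (with_proj H))"

text \<open>
  \<^const>\<open>pre_digraph.cycle\<close> also accepts the closed walk that uses an edge back and forth;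
  the condition \<open>3 \<le> length p\<close> excludes it.
\<close>

definition chordless_cycle :: "'a pair_pre_digraph \<Rightarrow> ('a \<times> 'a) list \<Rightarrow> bool" where
  "chordless_cycle G p \<longleftrightarrow>
    pre_digraph.cycle (with_proj G) p \<and> 3 \<le> length p \<and>
    (\<forall>u \<in> fst ` set p. \<forall>v \<in> fst ` set p.
        (u, v) \<in> parcs G \<longrightarrow> (u, v) \<in> set p \<or> (v, u) \<in> set p)"

definition chordality_at_most :: "nat \<Rightarrow> 'a pair_pre_digraph \<Rightarrow> bool" where
  "chordality_at_most k G \<longleftrightarrow> (\<forall>p. chordless_cycle G p \<longrightarrow> length p \<le> k)"

definition complete_bipartite :: "nat \<Rightarrow> nat \<Rightarrow> nat pair_pre_digraph" where
  "complete_bipartite m n =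
    \<lparr> pverts = {..<m + n},
      parcs = {..<m} \<times> {m..<m + n} \<union> {m..<m + n} \<times> {..<m} \<rparr>"

lemma complete_bipartite_correct: "K\<^bsub>m,n\<^esub> (with_proj (complete_bipartite m n))"
  unfolding complete_bipartite_digraph_pair_def complete_bipartite_def
  by (intro conjI exI[of _ "{..<m}"] exI[of _ "{m..<m + n}"]) auto

text \<open>Meaningful only for \<open>u \<in> pverts G\<close> and \<open>w \<notin> pverts G\<close>.\<close>

definition add_pendant :: "'a \<Rightarrow> 'a \<Rightarrow> 'a pair_pre_digraph \<Rightarrow> 'a pair_pre_digraph" where
  "add_pendant u w G =
    \<lparr> pverts = insert w (pverts G), parcs = parcs G \<union> {(u, w), (w, u)} \<rparr>"

text \<open>
  In \<open>complete_bipartite 2 p\<close> the part of size 2 is \<open>{0, 1}\<close>. The degree-one vertex \<open>w\<close> of \<open>L(1,p)\<close>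
  is \<open>p + 2\<close>, attached to \<open>0\<close>; the additional vertex of \<open>M(p)\<close> is \<open>p + 3\<close>, attached to \<open>w\<close>.
\<close>

definition graph_L1 :: "nat \<Rightarrow> nat pair_pre_digraph" where
  "graph_L1 p = add_pendant 0 (p + 2) (complete_bipartite 2 p)"

definition graph_M :: "nat \<Rightarrow> nat pair_pre_digraph" where
  "graph_M p = add_pendant (p + 2) (p + 3) (graph_L1 p)"

lemma pair_graph_graph_M: "pair_graph (graph_M p)"
  by unfold_locales
     (auto simp: graph_M_def graph_L1_def add_pendant_def complete_bipartite_def
        symmetric_def intro!: symI)

definition hereditary :: "'a pair_pre_digraph set \<Rightarrow> bool" where
  "hereditary X \<longleftrightarrow>
    (\<forall>G \<in> X. \<forall>H. induced_subgraph (with_proj H) (with_proj G) \<longrightarrow> H \<in> X)"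

definition labelled_count :: "nat pair_pre_digraph set \<Rightarrow> nat \<Rightarrow> nat" where
  "labelled_count X n = card {G \<in> X. pverts G = {1..n}}"

lemma finite_labelled: "finite {G. pair_graph G \<and> pverts G = {1..n::nat}}"
proof (rule finite_subset)
  show "{G. pair_graph G \<and> pverts G = {1..n}}
    \<subseteq> (\<lambda>E. \<lparr>pverts = {1..n}, parcs = E\<rparr>) ` Pow ({1..n} \<times> {1..n})"
  proof
    fix G :: "nat pair_pre_digraph"
    assume "G \<in> {G. pair_graph G \<and> pverts G = {1..n}}"
    then have G: "pair_graph G" "pverts G = {1..n}" by auto
    interpret pair_graph G by (fact G(1))
    have "parcs G \<subseteq> {1..n} \<times> {1..n}"
      using in_arcsD1 in_arcsD2 G(2) by auto
    moreover have "G = \<lparr>pverts = {1..n}, parcs = parcs G\<rparr>"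
      using G(2) by simp
    ultimately show "G \<in> (\<lambda>E. \<lparr>pverts = {1..n}, parcs = E\<rparr>) ` Pow ({1..n} \<times> {1..n})"
      by blast
  qed
qed simp

text \<open>
  The bound \<open>2\<^bsup>O(n log n)\<^esup>\<close> is read as \<open>\<le> 2\<^bsup>f(n)\<^esup>\<close> with \<open>f \<in> O(n log n)\<close>. Being at most
  factorial is a notion for hereditary classes, hence the first conjunct.
\<close>

definition at_most_factorial :: "nat pair_pre_digraph set \<Rightarrow> bool" where
  "at_most_factorial X \<longleftrightarrow>
    hereditary X \<and>
    (\<exists>f :: nat \<Rightarrow> real. f \<in> O(\<lambda>n. real n * ln (real n)) \<and>
      (\<forall>n. real (labelled_count X n) \<le> 2 powr f n))"

end

theory Submission
  imports Defs "HOL-Real_Asymp.Real_Asymp"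
begin

text \<open>
  Every nonempty \<open>M(p)\<close>-free bipartite graph of chordality at most \<open>k\<close> has a vertex of degree at most
  \<open>c\<close> or two vertices whose neighbourhoods differ in at most \<open>c\<close> elements, for a constant \<open>c\<close> that
  depends on \<open>k\<close> and \<open>p\<close> only. Such a vertex can be deleted and later restored from \<open>O(log n)\<close> bits:
  its name, the name of its near twin, and the names of the at most \<open>c\<close> exceptional neighbours. As the
  class is hereditary, deleting vertices until none is left encodes a graph by \<open>O(n log n)\<close> bits
  (\<open>card_labelled_le\<close>).

  Two observations give the vertex. First, in a graph with bounded induced cycles and large degrees,
  the neighbours of an end of a longest induced path must attach to few other vertices of the path;
  this produces two vertices with a large common neighbourhood \<open>S\<close>
  (\<open>common_neighbours_if_large_degrees\<close>). Second, \<open>M(p)\<close>-freeness says that if \<open>w\<close> is adjacent to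
  exactly one of two vertices, then all neighbours of \<open>w\<close> see almost all of their common
  neighbourhood. Starting from a large \<open>S\<close> this has a strong consequence: any two vertices that could
  distinguish neighbours of \<open>w\<close> are near twins or have nested neighbourhoods, and in the latter case
  the elements of the smallest of these neighbourhoods cannot be distinguished at all
  (\<open>near_twins_if_many_common_neighbours\<close>).
\<close>

section \<open>Large common neighbourhoods and near twins\<close>

text \<open>
  What remains of \<open>M(p)\<close>-freeness once the bipartition is forgotten. If \<open>z\<close> missed \<open>p + 1\<close> common
  neighbours of \<open>a\<close> and \<open>b\<close>, then \<open>p\<close> of these together with \<open>a\<close>, \<open>b\<close>, \<open>w\<close>, \<open>z\<close> would induce \<open>M(p)\<close>: \<open>a\<close> and
  \<open>b\<close> form the part of size two of \<open>K\<^bsub>2,p\<^esub>\<close>, \<open>w\<close> is the pendant neighbour of \<open>a\<close>, and \<open>z\<close> hangs at \<open>w\<close>. The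
  bound is \<open>p\<close> rather than \<open>p - 1\<close> so that a violation has a missed vertex also for \<open>p = 0\<close>: a common
  neighbour missed by \<open>z\<close> puts \<open>a\<close>, \<open>b\<close>, \<open>z\<close> on one side and separates \<open>z\<close> from \<open>a\<close>.
\<close>

definition few_missed :: "nat \<Rightarrow> ('a \<times> 'a) set \<Rightarrow> bool" where
  "few_missed p E \<longleftrightarrow>
    (\<forall>a b w z. (a, w) \<in> E \<longrightarrow> (b, w) \<notin> E \<longrightarrow> (w, z) \<in> E \<longrightarrow>
      card (E `` {a} \<inter> E `` {b} - E `` {z}) \<le> p)"

lemma few_missedD:
  assumes "few_missed p E" "(a, w) \<in> E" "(b, w) \<notin> E" "(w, z) \<in> E"
  shows "card (E `` {a} \<inter> E `` {b} - E `` {z}) \<le> p"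
  using assms unfolding few_missed_def by blast

text \<open>
  Let \<open>S\<close> be the common neighbourhood of \<open>a\<close> and \<open>b\<close>. Consider the vertices \<open>r\<close> whose neighbours all
  miss only a few elements of \<open>S\<close>; the vertex \<open>w0\<close>, which tells \<open>a\<close> from \<open>b\<close>, is one of them. Two
  incomparable neighbourhoods of such vertices differ by at most \<open>p\<close> elements on each side, since
  otherwise some \<open>s \<in> S\<close> and these two vertices yield a violation of \<open>few_missed\<close>. Hence if near
  twins did not exist, these neighbourhoods would form a chain with a least element \<open>N(w1)\<close>. Any
  vertex that separates two elements of \<open>N(w1)\<close> is again one of the considered vertices, so its
  neighbourhood contains all of \<open>N(w1)\<close>, a contradiction: the elements of \<open>N(w1)\<close> are twins.
\<close>

lemma near_twins_if_common_neighbours_distinguished: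
  fixes E :: "('a \<times> 'a) set"
  assumes fin: "finite E" and sym: "sym E" and fm: "few_missed p E"
    and many: "card (E `` {a} \<inter> E `` {b}) > 3 * p * (p + 2)"
    and deg: "\<And>x y. (x, y) \<in> E \<Longrightarrow> 2 \<le> card (E `` {x})"
    and w0: "(a, w0) \<in> E" "(b, w0) \<notin> E"
  shows "\<exists>x \<in> Field E. \<exists>y \<in> Field E.
    x \<noteq> y \<and> card (E `` {x} - E `` {y}) \<le> p \<and> card (E `` {y} - E `` {x}) \<le> p"
proof (rule ccontr)
  assume "\<not> ?thesis"
  then have no_twins: "\<And>x y. x \<in> Field E \<Longrightarrow> y \<in> Field E \<Longrightarrow> x \<noteq> y \<Longrightarrow> card (E `` {x} - E `` {y}) \<le> p \<Longrightarrow>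
      \<not> card (E `` {y} - E `` {x}) \<le> p"
    by blast
  have finN: "finite (E `` A)" for A
    using fin by (simp add: finite_Image)
  define S where "S = E `` {a} \<inter> E `` {b}"
  have finS: "finite S" unfolding S_def using finN by simp
  define T where "T j = {z. card (S - E `` {z}) \<le> j}" for j
  define W where "W = {r. E `` {r} \<subseteq> T (3 * p)}"
  have w0T: "E `` {w0} \<subseteq> T p"
    using few_missedD[OF fm w0] by (auto simp: T_def S_def)
  also have "T p \<subseteq> T (3 * p)" by (auto simp: T_def)
  finally have w0W: "w0 \<in> W" by (simp add: W_def)
  \<comment> \<open>Three losses of at most \<open>p\<close> add up here, whence the bound \<open>3 * p\<close> in \<open>W\<close>.\<close>
  have in_W: "r \<in> W" if t: "t \<in> T p" "t' \<in> T p" and r: "(t', r) \<in> E" "(t, r) \<notin> E" for t t' r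
  proof -
    have "card (S - E `` {z}) \<le> 3 * p" if "(r, z) \<in> E" for z
    proof -
      have "S - E `` {z} \<subseteq> (S - E `` {t}) \<union> (S - E `` {t'}) \<union> (E `` {t'} \<inter> E `` {t} - E `` {z})"
        by blast
      then have "card (S - E `` {z}) \<le> card ((S - E `` {t}) \<union> (S - E `` {t'}) \<union> (E `` {t'} \<inter> E `` {t} - E `` {z}))"
        by (intro card_mono) (auto simp: finS finN)
      also have "\<dots> \<le> card (S - E `` {t}) + card (S - E `` {t'}) + card (E `` {t'} \<inter> E `` {t} - E `` {z})"
        by (meson card_Un_le add_le_mono1 order_trans)
      also have "\<dots> \<le> p + p + p"
        using t few_missedD[OF fm r that] by (intro add_mono) (auto simp: T_def)
      finally show ?thesis by simp
    qed
    then show ?thesis by (auto simp: W_def T_def)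
  qed
  have chain: "E `` {r'} \<subseteq> E `` {r} \<or> card (E `` {r} - E `` {r'}) \<le> p" if r: "r \<in> W" "r' \<in> W" for r r'
  proof (rule ccontr)
    assume neg: "\<not> ?thesis"
    then obtain t where t: "(r', t) \<in> E" "(r, t) \<notin> E" by auto
    obtain M where M: "M \<subseteq> E `` {r} - E `` {r'}" "card M = Suc p" "finite M"
      using neg obtain_subset_with_card_n[of "Suc p" "E `` {r} - E `` {r'}"] by (auto simp: not_le Suc_le_eq)
    have MT: "insert t M \<subseteq> T (3 * p)" using M t r by (auto simp: W_def)
    \<comment> \<open>The \<open>p + 2\<close> elements of \<open>insert t M\<close> together miss at most \<open>3 * p * (p + 2)\<close> elements of \<open>S\<close>.\<close>
    obtain s where s: "s \<in> S" "\<forall>x\<in>insert t M. (x, s) \<in> E"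
    proof (rule ccontr)
      assume "\<not> thesis"
      then have "S \<subseteq> (\<Union>x\<in>insert t M. S - E `` {x})" using that by blast
      then have "card S \<le> card (\<Union>x\<in>insert t M. S - E `` {x})"
        by (intro card_mono) (auto simp: finS M)
      also have "\<dots> \<le> (\<Sum>x\<in>insert t M. card (S - E `` {x}))"
        using M by (intro card_UN_le) auto
      also have "\<dots> \<le> of_nat (card (insert t M)) * (3 * p)"
        using MT by (intro sum_bounded_above) (auto simp: T_def)
      also have "card (insert t M) = p + 2"
        using M t by (subst card_insert_disjoint) auto
      finally show False using many unfolding S_def by simp
    qed
    have "(s, t) \<in> E" "(t, r') \<in> E" "(r, t) \<notin> E"
      using s t sym by (auto dest: symD)
    from few_missedD[OF fm this(1,3,2)]
    have "card (E `` {s} \<inter> E `` {r} - E `` {r'}) \<le> p" .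
    moreover have "M \<subseteq> E `` {s} \<inter> E `` {r} - E `` {r'}"
      using s M sym by (auto dest: symD)
    then have "card M \<le> card (E `` {s} \<inter> E `` {r} - E `` {r'})"
      by (intro card_mono) (auto simp: finN)
    ultimately show False using M by simp
  qed
  have "w0 \<in> W \<inter> Field E" using w0W w0 by (auto simp: Field_def)
  then obtain w1 where w1: "w1 \<in> W \<inter> Field E"
    and min: "\<And>r. r \<in> W \<inter> Field E \<Longrightarrow> card (E `` {w1}) \<le> card (E `` {r})"
    using ex_has_least_nat[of "\<lambda>r. r \<in> W \<inter> Field E" w0 "\<lambda>r. card (E `` {r})"] by auto
  have below: "E `` {w1} \<subseteq> E `` {r}" if r: "r \<in> W" "r \<in> Field E" for r
  proof (rule ccontr)
    assume n1: "\<not> ?thesis"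
    then have "card (E `` {r} - E `` {w1}) \<le> p" using chain[of r w1] r w1 by auto
    moreover have "\<not> E `` {r} \<subseteq> E `` {w1}"
    proof
      assume "E `` {r} \<subseteq> E `` {w1}"
      then have "card (E `` {r}) < card (E `` {w1})"
        using n1 by (intro psubset_card_mono finN) auto
      then show False using min[of r] r by simp
    qed
    then have "card (E `` {w1} - E `` {r}) \<le> p" using chain[of w1 r] r w1 by auto
    moreover have "r \<noteq> w1" using n1 by auto
    ultimately show False using no_twins[of r w1] r w1 by auto
  qed
  obtain y where "(w1, y) \<in> E" using w1 sym by (auto simp: Field_def dest: symD)
  then have "2 \<le> card (E `` {w1})" using deg by blast
  then obtain t t' where t: "t \<in> E `` {w1}" "t' \<in> E `` {w1}" "t \<noteq> t'"
    by (auto simp: numeral_2_eq_2 card_le_Suc_iff)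
  have sub: "E `` {t'} \<subseteq> E `` {t}" if t: "t \<in> E `` {w1}" "t' \<in> E `` {w1}" for t t'
  proof
    fix r assume r: "r \<in> E `` {t'}"
    show "r \<in> E `` {t}"
    proof (rule ccontr)
      assume nr: "r \<notin> E `` {t}"
      have "E `` {w1} \<subseteq> T p"
        using below[OF w0W] w0 w0T by (auto simp: Field_def)
      then have "r \<in> W" using in_W[of t t' r] t r nr by auto
      then have "t \<in> E `` {r}" using below[of r] t r by (auto simp: Field_def)
      then show False using nr sym by (auto dest: symD)
    qed
  qed
  have "E `` {t'} = E `` {t}" using sub t by blast
  then show False using no_twins[of t t'] t by (auto simp: Field_def)
qed

lemma near_twins_if_many_common_neighbours:
  fixes E :: "('a \<times> 'a) set"
  assumes fin: "finite E" and sym: "sym E" and fm: "few_missed p E"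
    and ab: "a \<noteq> b" and many: "card (E `` {a} \<inter> E `` {b}) > 3 * p * (p + 2)"
    and deg: "\<And>x y. (x, y) \<in> E \<Longrightarrow> 2 \<le> card (E `` {x})"
  shows "\<exists>x \<in> Field E. \<exists>y \<in> Field E.
    x \<noteq> y \<and> card (E `` {x} - E `` {y}) \<le> p \<and> card (E `` {y} - E `` {x}) \<le> p"
proof -
  consider w where "(a, w) \<in> E" "(b, w) \<notin> E" | w where "(b, w) \<in> E" "(a, w) \<notin> E"
    | "E `` {a} = E `` {b}"
    by blast
  then show ?thesis
  proof cases
    case 1
    then show ?thesis using near_twins_if_common_neighbours_distinguished[OF fin sym fm many _ 1] deg by blast
  next
    case 2
    then show ?thesis
      using near_twins_if_common_neighbours_distinguished[OF fin sym fm _ _ 2] many deg by (auto simp: Int_commute)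
  next
    case 3
    have "E `` {a} \<inter> E `` {b} \<noteq> {}" using many by force
    then have "a \<in> Field E" "b \<in> Field E" by (auto simp: Field_def)
    then show ?thesis using 3 ab by (metis Diff_cancel card.empty le0)
  qed
qed

section \<open>Bounded induced cycles and large common neighbourhoods\<close>

definition induced_path :: "('a \<times> 'a) set \<Rightarrow> 'a list \<Rightarrow> bool" where
  "induced_path E vs \<longleftrightarrow> distinct vs \<and>
    (\<forall>i<length vs. \<forall>j<length vs. (vs ! i, vs ! j) \<in> E \<longleftrightarrow> i = Suc j \<or> j = Suc i)"

lemma induced_path_take: "induced_path E vs \<Longrightarrow> induced_path E (take n vs)"
  by (auto simp: induced_path_def)

lemma induced_path_Cons:
  assumes vs: "induced_path E vs" "vs \<noteq> []" and "sym E" "(u, u) \<notin> E"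
    and u: "u \<notin> set vs" "(u, vs ! 0) \<in> E" "\<And>j. 0 < j \<Longrightarrow> j < length vs \<Longrightarrow> (u, vs ! j) \<notin> E"
  shows "induced_path E (u # vs)"
proof -
  have u_iff: "(u, vs ! j) \<in> E \<longleftrightarrow> j = 0" if "j < length vs" for j
    using u that by (cases j) auto
  have iff_u: "(vs ! j, u) \<in> E \<longleftrightarrow> j = 0" if "j < length vs" for j
    using u_iff[OF that] \<open>sym E\<close> by (meson symD)
  show ?thesis
    using vs u(1) u_iff iff_u \<open>(u, u) \<notin> E\<close>
    by (auto simp: induced_path_def nth_Cons split: nat.splits)
qed

text \<open>
  The arcs of the closed walk through the vertices \<open>u # xs\<close> are \<open>zip (u # xs) (xs @ [u])\<close>.
\<close>

lemma pcas_zip: "pcas u (zip (u # xs) (xs @ [v])) v"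
  by (induction xs arbitrary: u) auto

lemma pawalk_verts_zip: "pawalk_verts u (zip (u # xs) (xs @ [v])) = u # xs @ [v]"
  by (induction xs arbitrary: u) auto

lemma chordless_cycle_close_path:
  assumes G: "pair_graph G" and vs: "induced_path (parcs G) vs" "2 \<le> length vs"
    and u: "u \<notin> set vs" "(u, vs ! 0) \<in> parcs G" "(u, last vs) \<in> parcs G"
      "\<And>j. 0 < j \<Longrightarrow> j < length vs - 1 \<Longrightarrow> (u, vs ! j) \<notin> parcs G"
  shows "chordless_cycle G (zip (u # vs) (vs @ [u]))"
proof -
  interpret pair_graph G by (fact G)
  let ?p = "zip (u # vs) (vs @ [u])" and ?m = "length vs"
  have sym: "(x, y) \<in> parcs G \<Longrightarrow> (y, x) \<in> parcs G" for x y
    using pair_sym_arcs by (auto simp: symmetric_def dest: symD)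
  have last_nth: "last vs = vs ! (?m - 1)"
    using vs(2) by (intro last_conv_nth) auto
  have set_p: "set ?p = {(u, vs ! 0), (last vs, u)} \<union> {(vs ! i, vs ! Suc i) | i. Suc i < ?m}" (is "_ = ?R")
  proof -
    have nth: "?p ! i = (if i = 0 then (u, vs ! 0) else if i = ?m then (last vs, u) else (vs ! (i - 1), vs ! i))"
      if "i \<le> ?m" for i
    proof (cases i)
      case 0
      then show ?thesis using vs(2) by (auto simp: nth_append)
    next
      case (Suc n)
      then show ?thesis using that last_nth by (cases "i = ?m") (auto simp: nth_append)
    qed
    have "set ?p = (\<lambda>i. ?p ! i) ` {..?m}"
    proof -
      have "length ?p = Suc ?m" by simp
      then show ?thesis
        unfolding set_conv_nth by (auto simp: less_Suc_eq_le simp del: zip_Cons_Cons nth_zip)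
    qed
    also have "\<dots> = ?R"
    proof (intro equalityI subsetI)
      fix e assume "e \<in> (\<lambda>i. ?p ! i) ` {..?m}"
      then obtain i where "i \<le> ?m" "e = ?p ! i" by auto
      then show "e \<in> ?R" using nth[of i] by (cases i) (auto split: if_splits)
    next
      fix e assume "e \<in> ?R"
      then consider "e = (u, vs ! 0)" | "e = (last vs, u)" | i where "Suc i < ?m" "e = (vs ! i, vs ! Suc i)"
        by blast
      then show "e \<in> (\<lambda>i. ?p ! i) ` {..?m}"
      proof cases
        case 1
        then show ?thesis using nth[of 0] by (intro image_eqI[of _ _ 0]) auto
      next
        case 2
        then show ?thesis using nth[of ?m] vs(2) by (intro image_eqI[of _ _ ?m]) auto
      next
        case (3 i)
        then show ?thesis using nth[of "Suc i"] by (intro image_eqI[of _ _ "Suc i"]) auto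
      qed
    qed
    finally show ?thesis .
  qed
  have path: "(vs ! i, vs ! j) \<in> parcs G \<longleftrightarrow> i = Suc j \<or> j = Suc i" if "i < ?m" "j < ?m" for i j
    using vs that by (auto simp: induced_path_def)
  have "awalk u ?p u"
    unfolding awalk_def using pcas_zip[of u vs u] u path sym in_arcsD1 set_p by auto
  moreover have "distinct (tl (pawalk_verts u ?p))"
    using vs u unfolding pawalk_verts_zip by (auto simp: induced_path_def)
  ultimately have "cycle ?p" using vs by (auto simp: cycle_def)
  moreover have "(x, y) \<in> set ?p \<or> (y, x) \<in> set ?p"
    if x: "x \<in> fst ` set ?p" and y: "y \<in> fst ` set ?p" and xy: "(x, y) \<in> parcs G" for x y
  proof -
    have fst_p: "fst ` set ?p = insert u (set vs)"
      by (metis length_Cons length_append_singleton list.set(2) list.set_map map_fst_zip)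
    have ends: "(u, y) \<in> set ?p \<or> (y, u) \<in> set ?p" if y: "y \<in> set vs" "(u, y) \<in> parcs G" for y
    proof -
      obtain j where "j < ?m" "y = vs ! j" using y by (auto simp: in_set_conv_nth)
      moreover have "j = 0 \<or> j = ?m - 1" using u(4)[of j] y calculation by force
      ultimately have "y = vs ! 0 \<or> y = last vs" using last_nth by auto
      then show ?thesis using set_p by auto
    qed
    consider "x = u" "y = u" | "x = u" "y \<in> set vs" | "x \<in> set vs" "y = u" | "x \<in> set vs" "y \<in> set vs"
      using x y unfolding fst_p by auto
    then show ?thesis
    proof cases
      case 1
      then show ?thesis using xy no_loops' by blast
    next
      case 2
      then show ?thesis using ends xy by auto
    next
      case 3
      then show ?thesis using ends[of x] sym[OF xy] by auto
    next
      case 4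
      then obtain i j where ij: "i < ?m" "x = vs ! i" "j < ?m" "y = vs ! j"
        by (auto simp: in_set_conv_nth)
      then have "i = Suc j \<or> j = Suc i" using path xy by auto
      then show ?thesis using ij unfolding set_p by auto
    qed
  qed
  ultimately show ?thesis using vs by (auto simp: chordless_cycle_def)
qed

text \<open>
  Let \<open>v\<close> be an end of a longest induced path. Each neighbour of \<open>v\<close> off the path has a further
  neighbour on the path, since otherwise it would prolong the path. The nearest such neighbour
  closes an induced cycle, so it is one of the fewer than \<open>k\<close> path vertices that are close to \<open>v\<close>. By
  pigeonhole, one of these has more than \<open>q\<close> common neighbours with \<open>v\<close>.
\<close>

lemma common_neighbours_if_large_degrees:
  assumes G: "pair_graph G" and ne: "pverts G \<noteq> {}" and chord: "chordality_at_most k G"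
    and deg: "\<And>x. x \<in> pverts G \<Longrightarrow> k * q + 1 < card (parcs G `` {x})"
  shows "\<exists>a b. a \<noteq> b \<and> q < card (parcs G `` {a} \<inter> parcs G `` {b})"
proof (rule ccontr)
  interpret pair_graph G by (fact G)
  let ?E = "parcs G"
  assume "\<not> ?thesis"
  then have few: "a \<noteq> b \<Longrightarrow> card (?E `` {a} \<inter> ?E `` {b}) \<le> q" for a b by (auto simp: not_less)
  have sym: "sym ?E" using pair_sym_arcs by (simp add: symmetric_def)
  have fin: "finite (?E `` A)" for A using pair_finite_arcs by (rule finite_Image)
  let ?P = "\<lambda>vs. induced_path ?E vs \<and> vs \<noteq> [] \<and> set vs \<subseteq> pverts G"
  obtain v where v: "v \<in> pverts G" using ne by blast
  have P1: "?P [v]" using v no_loops' by (auto simp: induced_path_def)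
  have bounded: "length vs < Suc (card (pverts G))" if "?P vs" for vs
    using that card_mono[OF pair_finite_verts, of "set vs"]
    by (auto simp: induced_path_def distinct_card)
  obtain vs where vs: "?P vs" and longest: "\<And>ws. ?P ws \<Longrightarrow> length ws \<le> length vs"
    using ex_has_greatest_nat[where P = ?P and f = length, OF P1, of "Suc (card (pverts G))"] bounded
    by (meson less_imp_le)
  let ?v = "\<lambda>i. vs ! i"
  have "\<exists>j. 0 < j \<and> j < k \<and> j < length vs \<and> (u, ?v j) \<in> ?E" if u: "(?v 0, u) \<in> ?E" "u \<noteq> ?v 1" for u
  proof -
    have u0: "(u, ?v 0) \<in> ?E" using sym u by (rule_tac symD)
    have u_new: "u \<notin> set vs"
    proof
      assume "u \<in> set vs"
      then obtain i where "i < length vs" "u = ?v i" by (auto simp: in_set_conv_nth)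
      then show False using u vs unfolding induced_path_def by (metis length_greater_0_conv nat.distinct(1) One_nat_def)
    qed
    have "\<exists>j. 0 < j \<and> j < length vs \<and> (u, ?v j) \<in> ?E"
    proof (rule ccontr)
      assume "\<not> ?thesis"
      then have "induced_path ?E (u # vs)"
        using vs u_new u0 sym no_loops' by (intro induced_path_Cons) auto
      then show False using longest[of "u # vs"] vs u in_arcsD2 by auto
    qed
    then obtain j where j: "0 < j" "j < length vs" "(u, ?v j) \<in> ?E"
      and least': "\<forall>i<j. \<not> (0 < i \<and> i < length vs \<and> (u, ?v i) \<in> ?E)"
      using exists_least_iff[of "\<lambda>j. 0 < j \<and> j < length vs \<and> (u, ?v j) \<in> ?E"] by blast
    have least: "(u, ?v i) \<notin> ?E" if "0 < i" "i < j" for i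
      using least' that j by auto
    let ?ws = "take (Suc j) vs"
    have "chordless_cycle G (zip (u # ?ws) (?ws @ [u]))"
    proof (rule chordless_cycle_close_path[OF G])
      show "induced_path ?E ?ws" using vs by (simp add: induced_path_take)
      show "u \<notin> set ?ws" using u_new by (meson in_set_takeD)
      show "(u, last ?ws) \<in> ?E" using j by (simp add: take_Suc_conv_app_nth)
    qed (use j u0 least in auto)
    then have "length (zip (u # ?ws) (?ws @ [u])) \<le> k"
      using chord by (simp only: chordality_at_most_def)
    then have "j + 2 \<le> k" using j by simp
    then show ?thesis using j by auto
  qed
  then have "?E `` {?v 0} \<subseteq> insert (?v 1) (\<Union>j\<in>{0<..<min k (length vs)}. ?E `` {?v 0} \<inter> ?E `` {?v j})"
    using sym by (fastforce dest: symD)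
  then have "card (?E `` {?v 0}) \<le> card \<dots>"
    by (intro card_mono) (auto simp: fin)
  also have "\<dots> \<le> Suc (card (\<Union>j\<in>{0<..<min k (length vs)}. ?E `` {?v 0} \<inter> ?E `` {?v j}))"
    by (rule card_insert_le_m1) auto
  also have "\<dots> \<le> Suc (\<Sum>j\<in>{0<..<min k (length vs)}. card (?E `` {?v 0} \<inter> ?E `` {?v j}))"
    by (simp only: Suc_le_mono) (rule card_UN_le, simp)
  also have "\<dots> \<le> Suc (\<Sum>j\<in>{0<..<min k (length vs)}. q)"
  proof -
    have "?v 0 \<noteq> ?v j" if "j \<in> {0<..<min k (length vs)}" for j
      using vs that by (auto simp: induced_path_def nth_eq_iff_index_eq)
    then show ?thesis using few by (intro Suc_leI le_imp_less_Suc sum_mono) auto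
  qed
  also have "\<dots> \<le> k * q + 1" by auto
  finally show False using deg[of "?v 0"] vs by (force simp: not_less)
qed

section \<open>The induced subgraph forced by many missed vertices\<close>

lemma few_missed_if_induced_free_M:
  assumes G: "pair_graph G" and bip: "bipartite G" and free: "induced_free (graph_M p) G"
  shows "few_missed p (parcs G)"
  unfolding few_missed_def
proof (intro allI impI, rule ccontr)
  interpret pair_graph G by (fact G)
  let ?E = "parcs G"
  fix a b w z
  assume aw: "(a, w) \<in> ?E" and bw: "(b, w) \<notin> ?E" and wz: "(w, z) \<in> ?E"
    and many: "\<not> card (?E `` {a} \<inter> ?E `` {b} - ?E `` {z}) \<le> p"
  have sym: "(x, y) \<in> ?E \<longleftrightarrow> (y, x) \<in> ?E" for x y
    using pair_sym_arcs by (auto simp: symmetric_def dest: symD)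
  define Q where "Q = ?E `` {a} \<inter> ?E `` {b} - ?E `` {z}"
  have "card Q > p" using many by (simp add: Q_def)
  then obtain P where P: "P \<subseteq> Q" "card P = p" "finite P"
    using obtain_subset_with_card_n[of p Q] by auto
  \<comment> \<open>The set \<open>P\<close> may be empty, so \<open>q\<close> witnesses that \<open>a\<close> and \<open>b\<close> lie on the same side.\<close>
  obtain q where q: "q \<in> Q" using \<open>card Q > p\<close> by fastforce
  obtain A B where AB: "A \<inter> B = {}" "?E \<subseteq> A \<times> B \<union> B \<times> A"
    using bip unfolding bipartite_def by blast
  then have A: "x \<in> A \<longleftrightarrow> y \<notin> A" if "(x, y) \<in> ?E" for x y
    using that by blast
  have side: "b \<in> A \<longleftrightarrow> a \<in> A" "w \<in> A \<longleftrightarrow> a \<notin> A" "z \<in> A \<longleftrightarrow> a \<in> A"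
    using q A aw wz unfolding Q_def by blast+
  have side_P: "x \<in> A \<longleftrightarrow> a \<notin> A" if "x \<in> P" for x
    using that P(1) A unfolding Q_def by blast
  obtain e where e: "bij_betw e {2..<p + 2} P"
    using P finite_same_card_bij[of "{2..<p + 2}" P] by auto
  define g where "g i = (if i = 0 then a else if i = 1 then b else if i = p + 2 then w
      else if i = p + 3 then z else e i)" for i
  let ?M = "graph_M p"
  have Mverts: "pverts ?M = {0, 1, p + 2, p + 3} \<union> {2..<p + 2}"
    by (auto simp: graph_M_def graph_L1_def add_pendant_def complete_bipartite_def)
  have g_simps: "g 0 = a" "g 1 = b" "g (Suc 0) = b" "g (p + 2) = w" "g (Suc (Suc p)) = w" "g (p + 3) = z"
    and g_e: "\<And>i. i \<in> {2..<p + 2} \<Longrightarrow> g i = e i"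
    by (auto simp: g_def)
  have eP: "e i \<in> P" if "i \<in> {2..<p + 2}" for i
    using e that by (auto simp: bij_betw_def)
  have adj_P: "(a, x) \<in> ?E" "(b, x) \<in> ?E" "(z, x) \<notin> ?E" if "x \<in> P" for x
    using P(1) that by (auto simp: Q_def)
  have distinct: "a \<noteq> b" "z \<noteq> a" "z \<noteq> b"
    using aw bw wz sym q by (auto simp: Q_def)
  have w_P: "w \<notin> P" using adj_P bw by blast
  have inj: "inj_on g (pverts ?M)"
  proof -
    have "inj_on g {2..<p + 2}"
      using e by (subst inj_on_cong[OF g_e]) (auto simp: bij_betw_def)
    moreover have "g ` {2..<p + 2} = P"
      using e g_e by (auto simp: bij_betw_def)
    moreover have "inj_on g {0, 1, p + 2, p + 3}"
    proof -
      have "w \<noteq> a" "w \<noteq> b" "w \<noteq> z" using side by auto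
      then have "distinct (map g [0, 1, p + 2, p + 3])" using distinct g_simps by auto
      then have "inj_on g (set [0, 1, p + 2, p + 3])" by (simp only: distinct_map)
      then show ?thesis by simp
    qed
    moreover have "g ` {0, 1, p + 2, p + 3} \<inter> P = {}"
      using side side_P w_P g_simps by auto
    ultimately show ?thesis
      unfolding Mverts by (subst inj_on_Un) blast
  qed
  have arcs: "(g i, g j) \<in> ?E \<longleftrightarrow> (i, j) \<in> parcs ?M" if "i \<in> pverts ?M" "j \<in> pverts ?M" for i j
  proof -
    have parcs_M: "parcs ?M = {0, 1} \<times> {2..<p + 2} \<union> {2..<p + 2} \<times> {0, 1} \<union>
        {(0, p + 2), (p + 2, 0), (p + 2, p + 3), (p + 3, p + 2)}"
      by (auto simp: graph_M_def graph_L1_def add_pendant_def complete_bipartite_def)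
    \<comment> \<open>\<open>X\<close> and \<open>Y\<close> are the two sides of \<open>graph_M p\<close>.\<close>
    define X where "X = {0, 1, p + 3}"
    define Y where "Y = insert (p + 2) {2..<p + 2}"
    have XY: "(g i, g j) \<in> ?E \<longleftrightarrow> (i, j) \<in> parcs ?M" if "i \<in> X" "j \<in> Y" for i j
    proof -
      have i: "i = 0 \<or> i = 1 \<or> i = p + 3" using that by (simp add: X_def)
      show ?thesis
      proof (cases "j = p + 2")
        case True
        have "(z, w) \<in> ?E" using wz sym by blast
        then show ?thesis
          using i aw bw unfolding True g_simps parcs_M by (elim disjE) (simp_all add: g_simps)
      next
        case False
        then have j: "j \<in> {2..<p + 2}" using that by (simp add: Y_def)
        show ?thesis
          using i j adj_P[OF eP[OF j]] unfolding g_e[OF j] parcs_M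
          by (elim disjE) (simp_all add: g_simps)
      qed
    qed
    have X: "g i \<in> A \<longleftrightarrow> a \<in> A" if "i \<in> X" for i
    proof -
      have "i = 0 \<or> i = 1 \<or> i = p + 3" using that by (simp add: X_def)
      then show ?thesis using side by (elim disjE) (simp_all add: g_simps)
    qed
    have Y: "g i \<in> A \<longleftrightarrow> a \<notin> A" if "i \<in> Y" for i
    proof (cases "i = p + 2")
      case True
      then show ?thesis using side by (simp only: g_simps)
    next
      case False
      then have i: "i \<in> {2..<p + 2}" using that by (simp add: Y_def)
      show ?thesis using side_P[OF eP[OF i]] by (simp only: g_e[OF i])
    qed
    have M_X: "(i, j) \<in> parcs ?M \<Longrightarrow> i \<in> X \<Longrightarrow> j \<notin> X" for i j
      unfolding parcs_M X_def by auto
    have M_Y: "(i, j) \<in> parcs ?M \<Longrightarrow> i \<in> Y \<Longrightarrow> j \<notin> Y" for i j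
      unfolding parcs_M Y_def by auto
    have symM: "(i, j) \<in> parcs ?M \<longleftrightarrow> (j, i) \<in> parcs ?M"
      unfolding parcs_M by auto
    have "i \<in> X \<or> i \<in> Y" "j \<in> X \<or> j \<in> Y"
      using that unfolding Mverts X_def Y_def by auto
    then consider "i \<in> X" "j \<in> Y" | "i \<in> Y" "j \<in> X" | "i \<in> X" "j \<in> X" | "i \<in> Y" "j \<in> Y"
      by blast
    then show ?thesis
    proof cases
      case 1
      then show ?thesis by (rule XY)
    next
      case 2
      then show ?thesis using XY[of j i] symM sym[of "g i" "g j"] by simp
    next
      case 3
      then show ?thesis using X A M_X by metis
    next
      case 4
      then show ?thesis using Y A M_Y by metis
    qed
  qed
  define K where "K = \<lparr>pverts = g ` pverts ?M, parcs = {e \<in> ?E. fst e \<in> g ` pverts ?M \<and> snd e \<in> g ` pverts ?M}\<rparr>"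
  have sub: "induced_subgraph (with_proj K) (with_proj G)"
  proof -
    have "g ` pverts ?M \<subseteq> pverts G"
    proof -
      have "{a, b, w, z} \<subseteq> pverts G"
        using aw wz q in_arcsD1 in_arcsD2 unfolding Q_def by blast
      moreover have "P \<subseteq> pverts G" using adj_P in_arcsD2 by blast
      moreover have "g ` {2..<p + 2} = P" using e g_e by (auto simp: bij_betw_def)
      ultimately show ?thesis unfolding Mverts image_Un by (simp add: g_simps)
    qed
    moreover have "wf_digraph (with_proj K)"
      by (unfold_locales) (auto simp: K_def)
    moreover have "wf_digraph (with_proj G)" by unfold_locales
    ultimately show ?thesis
      by (auto simp: induced_subgraph_def subgraph_def K_def compatible_def)
  qed
  have "digraph_iso (with_proj ?M) (with_proj K)"
  proof -
    interpret M: pair_graph ?M by (rule pair_graph_graph_M)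
    let ?f = "\<lparr>iso_verts = g, iso_arcs = map_prod g g, iso_head = snd, iso_tail = fst\<rparr>"
    have "M.digraph_isomorphism ?f"
      unfolding M.digraph_isomorphism_def
      using inj M.in_arcsD1 M.in_arcsD2
      by (auto simp: inj_on_def intro: M.wf_digraph_axioms)
    moreover have "with_proj K = app_iso ?f (with_proj ?M)"
    proof -
      have "parcs K = map_prod g g ` parcs ?M"
      proof (intro equalityI subsetI)
        fix x assume "x \<in> parcs K"
        then obtain i j where "i \<in> pverts ?M" "j \<in> pverts ?M" "x = (g i, g j)" "(g i, g j) \<in> ?E"
          by (cases x) (auto simp: K_def)
        then show "x \<in> map_prod g g ` parcs ?M" using arcs by force
      next
        fix x assume "x \<in> map_prod g g ` parcs ?M"
        then show "x \<in> parcs K" using arcs M.in_arcsD1 M.in_arcsD2 by (fastforce simp: K_def)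
      qed
      then show ?thesis by (simp add: with_proj_def app_iso_def K_def)
    qed
    ultimately show ?thesis unfolding digraph_iso_def by blast
  qed
  then have "digraph_iso (with_proj K) (with_proj ?M)"
  proof -
    interpret M: pair_graph ?M by (rule pair_graph_graph_M)
    assume "digraph_iso (with_proj ?M) (with_proj K)"
    then show ?thesis by (rule digraph_iso_swap[OF M.wf_digraph_axioms])
  qed
  with sub free show False unfolding induced_free_def by blast
qed

section \<open>Closure under induced subgraphs\<close>

lemma induced_subgraph_iff:
  "induced_subgraph (with_proj H) (with_proj G) \<longleftrightarrow> pair_wf_digraph G \<and> pverts H \<subseteq> pverts G \<and>
    parcs H = parcs G \<inter> pverts H \<times> pverts H"
proof -
  have eq: "{e \<in> parcs G. fst e \<in> pverts H \<and> snd e \<in> pverts H} = parcs G \<inter> pverts H \<times> pverts H"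
    by auto
  have "pair_wf_digraph H" if arcs: "parcs H = parcs G \<inter> pverts H \<times> pverts H"
  proof
    fix e assume "e \<in> parcs H"
    then have "e \<in> pverts H \<times> pverts H" using arcs by blast
    then show "fst e \<in> pverts H" "snd e \<in> pverts H" by auto
  qed
  moreover have "parcs G \<inter> pverts H \<times> pverts H \<subseteq> parcs G" by blast
  ultimately show ?thesis
    unfolding induced_subgraph_def subgraph_def compatible_def wf_digraph_wp_iff with_proj_simps eq
    by metis
qed

lemma pair_graph_induced_subgraph:
  assumes "pair_graph G" and HG: "induced_subgraph (with_proj H) (with_proj G)"
  shows "pair_graph H"
proof -
  interpret pair_graph G by fact
  note H = HG[unfolded induced_subgraph_iff]
  have "sym (parcs H)"
    using H pair_sym_arcs unfolding symmetric_def by (auto simp: sym_def)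
  then have "symmetric (with_proj H)" by (simp add: symmetric_def)
  moreover have "finite (pverts H)" "finite (parcs H)"
    using H pair_finite_verts pair_finite_arcs by (auto intro: finite_subset)
  moreover have "fst e \<noteq> snd e" if "e \<in> parcs H" for e using that H pair_no_loops by blast
  ultimately show ?thesis
    using H by unfold_locales auto
qed

lemma hereditary_bounded_chordality_induced_free:
  "hereditary {G. pair_graph G \<and> bipartite G \<and> induced_free M G \<and> chordality_at_most k G}"
  unfolding hereditary_def
proof safe
  fix G H :: "'a pair_pre_digraph"
  assume G: "pair_graph G" and HG: "induced_subgraph (with_proj H) (with_proj G)"
  interpret pair_graph G by (fact G)
  note H = HG[unfolded induced_subgraph_iff]
  show "pair_graph H" using G HG by (rule pair_graph_induced_subgraph)
  show "bipartite H" if bip: "bipartite G"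
  proof -
    obtain A B where "pverts G = A \<union> B" "A \<inter> B = {}" "parcs G \<subseteq> A \<times> B \<union> B \<times> A"
      using bip unfolding bipartite_def by blast
    then show ?thesis
      unfolding bipartite_def using H
      by (intro exI[of _ "A \<inter> pverts H"] exI[of _ "B \<inter> pverts H"]) auto
  qed
  show "induced_free M H" if "induced_free M G"
  proof -
    have "induced_subgraph (with_proj K) (with_proj G)" if "induced_subgraph (with_proj K) (with_proj H)" for K
      using that H unfolding induced_subgraph_iff by blast
    then show ?thesis using \<open>induced_free M G\<close> unfolding induced_free_def by blast
  qed
  show "chordality_at_most k H" if chord: "chordality_at_most k G"
  proof -
    have "chordless_cycle G p" if p: "chordless_cycle H p" for p
    proof -
      have cyc: "pre_digraph.cycle (with_proj H) p" using p by (simp add: chordless_cycle_def)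
      then have "set p \<subseteq> parcs H" by (auto simp: pre_digraph.cycle_def pre_digraph.awalk_def)
      then have "fst ` set p \<subseteq> pverts H" using H by auto
      moreover have "cycle p"
        using subgraph_cycle[OF _ cyc] HG by (simp add: induced_subgraph_def)
      ultimately show ?thesis
        using p H unfolding chordless_cycle_def by blast
    qed
    then show ?thesis using chord by (auto simp: chordality_at_most_def)
  qed
qed

section \<open>Counting by vertex deletion\<close>

definition add_vertex :: "'a \<Rightarrow> 'a set \<Rightarrow> 'a pair_pre_digraph \<Rightarrow> 'a pair_pre_digraph" where
  "add_vertex x S H = \<lparr>pverts = insert x (pverts H), parcs = parcs H \<union> {x} \<times> S \<union> S \<times> {x}\<rparr>"

definition delete_vertex :: "'a \<Rightarrow> 'a pair_pre_digraph \<Rightarrow> 'a pair_pre_digraph" where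
  "delete_vertex x G = \<lparr>pverts = pverts G - {x}, parcs = parcs G \<inter> (pverts G - {x}) \<times> (pverts G - {x})\<rparr>"

lemma add_vertex_delete_vertex:
  assumes "pair_graph G" "x \<in> pverts G"
  shows "add_vertex x (parcs G `` {x}) (delete_vertex x G) = G"
proof -
  interpret pair_graph G by fact
  have "(y, x) \<in> parcs G \<longleftrightarrow> (x, y) \<in> parcs G" for y
    using pair_sym_arcs by (auto simp: symmetric_def dest: symD)
  then have "parcs (add_vertex x (parcs G `` {x}) (delete_vertex x G)) = parcs G"
    using in_arcsD1 in_arcsD2 by (auto simp: add_vertex_def delete_vertex_def)
  moreover have "pverts (add_vertex x (parcs G `` {x}) (delete_vertex x G)) = pverts G"
    using \<open>x \<in> pverts G\<close> by (auto simp: add_vertex_def delete_vertex_def)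
  ultimately show ?thesis by (intro pair_pre_digraph.equality) auto
qed

text \<open>
  Such a set is listed by a sequence of length \<open>c\<close> over the elements of \<open>V\<close> and a blank.
\<close>

lemma card_small_subsets:
  assumes "finite V"
  shows "card {X. X \<subseteq> V \<and> card X \<le> c} \<le> Suc (card V) ^ c"
proof -
  let ?L = "{xs :: 'a option list. set xs \<subseteq> insert None (Some ` V) \<and> length xs = c}"
  have finL: "finite ?L" using assms by (intro finite_lists_length_eq) auto
  have "{X. X \<subseteq> V \<and> card X \<le> c} \<subseteq> (\<lambda>xs. {x. Some x \<in> set xs}) ` ?L"
  proof
    fix X assume X: "X \<in> {X. X \<subseteq> V \<and> card X \<le> c}"
    then have "finite X" using assms finite_subset by auto
    then obtain xs where xs: "set xs = X" "distinct xs" using finite_distinct_list by blast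
    then have "length xs \<le> c" using X distinct_card by force
    then show "X \<in> (\<lambda>xs. {x. Some x \<in> set xs}) ` ?L"
      using X xs by (intro image_eqI[of _ _ "map Some xs @ replicate (c - length xs) None"])
        (auto split: if_splits)
  qed
  then have "card {X. X \<subseteq> V \<and> card X \<le> c} \<le> card ?L"
    using finL by (meson card_image_le card_mono finite_imageI order_trans)
  also have "\<dots> = card (insert None (Some ` V)) ^ c"
    using assms by (intro card_lists_length_eq) auto
  also have "card (insert None (Some ` V)) = Suc (card V)"
    using assms by (simp add: card_image)
  finally show ?thesis .
qed

text \<open>
  A graph is recovered from \<open>G - x\<close> together with \<open>x\<close> and \<open>N(x)\<close>. If \<open>N(x)\<close> is small or close to
  \<open>N(y)\<close>, then \<open>N(x)\<close> is the symmetric difference of a neighbourhood in \<open>G - x\<close> and a set of at most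
  \<open>c\<close> vertices, so that only polynomially many choices arise: \<open>n\<close> for \<open>x\<close>, \<open>n\<close> for \<open>y\<close> and
  \<open>(n + 1)\<^sup>c\<close> for the correction. Iterating over the vertices gives \<open>2\<^bsup>O(n log n)\<^esup>\<close>.
\<close>

lemma card_labelled_le:
  fixes \<X> :: "'a pair_pre_digraph set"
  assumes graphs: "\<And>G. G \<in> \<X> \<Longrightarrow> pair_graph G" and her: "hereditary \<X>"
    and reducible: "\<And>G. G \<in> \<X> \<Longrightarrow> pverts G \<noteq> {} \<Longrightarrow> \<exists>x \<in> pverts G.
      card (parcs G `` {x}) \<le> c \<or>
      (\<exists>y \<in> pverts G - {x}. card (sym_diff (parcs G `` {x}) (parcs G `` {y})) \<le> c)"
    and "finite V" "card V = n"
  shows "finite {G \<in> \<X>. pverts G = V} \<and> card {G \<in> \<X>. pverts G = V} \<le> Suc n ^ ((c + 2) * n)"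
  using \<open>finite V\<close> \<open>card V = n\<close>
proof (induction n arbitrary: V)
  case 0
  have "{G \<in> \<X>. pverts G = V} \<subseteq> {\<lparr>pverts = {}, parcs = {}\<rparr>}"
  proof
    fix G assume G: "G \<in> {G \<in> \<X>. pverts G = V}"
    then interpret pair_graph G using graphs by blast
    have "pverts G = {}" using G 0 by simp
    then have "parcs G = {}" using in_arcsD1 by fastforce
    then show "G \<in> {\<lparr>pverts = {}, parcs = {}\<rparr>}" using \<open>pverts G = {}\<close> by simp
  qed
  then have "finite {G \<in> \<X>. pverts G = V}" "card {G \<in> \<X>. pverts G = V} \<le> 1"
    using card_mono[of "{\<lparr>pverts = {}, parcs = {}\<rparr>}" "{G \<in> \<X>. pverts G = V}"]
    by (auto intro: finite_subset)
  then show ?case by simp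
next
  case (Suc n)
  let ?C = "\<lambda>V. {G \<in> \<X>. pverts G = V}"
  let ?S = "{X. X \<subseteq> V \<and> card X \<le> c}"
  let ?D = "SIGMA x:V. V \<times> ?S \<times> ?C (V - {x})"
  let ?f = "\<lambda>(x, y, X, H). add_vertex x (sym_diff (parcs H `` {y}) X) H"
  have IH: "finite (?C (V - {x}))" "card (?C (V - {x})) \<le> Suc n ^ ((c + 2) * n)" if "x \<in> V" for x
    using Suc.IH[of "V - {x}"] Suc.prems that by auto
  have finS: "finite ?S" using Suc.prems by simp
  have "finite ?D" using Suc.prems IH finS by (intro finite_SigmaI finite_cartesian_product) auto
  have "card ?D = (\<Sum>x\<in>V. card V * (card ?S * card (?C (V - {x}))))"
    using Suc.prems IH finS by (subst card_SigmaI) (auto simp: card_cartesian_product)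
  also have "\<dots> \<le> (\<Sum>x\<in>V. Suc (Suc n) * (Suc (Suc n) ^ c * Suc (Suc n) ^ ((c + 2) * n)))"
  proof (intro sum_mono mult_mono)
    fix x assume "x \<in> V"
    have "card (?C (V - {x})) \<le> Suc n ^ ((c + 2) * n)" using IH \<open>x \<in> V\<close> by blast
    also have "\<dots> \<le> Suc (Suc n) ^ ((c + 2) * n)" by (intro power_mono) auto
    finally show "card (?C (V - {x})) \<le> Suc (Suc n) ^ ((c + 2) * n)" .
  qed (use Suc.prems card_small_subsets[of V c] in auto)
  also have "\<dots> \<le> Suc (Suc n) * (Suc (Suc n) * (Suc (Suc n) ^ c * Suc (Suc n) ^ ((c + 2) * n)))"
    using Suc.prems by (simp del: mult_Suc)
  also have "\<dots> = Suc (Suc n) ^ ((c + 2) * Suc n)"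
    by (simp add: power_add algebra_simps del: mult_Suc)
  finally have card_D: "card ?D \<le> Suc (Suc n) ^ ((c + 2) * Suc n)" .
  have "?C V \<subseteq> ?f ` ?D"
  proof
    fix G assume "G \<in> ?C V"
    then have G: "G \<in> \<X>" "pverts G = V" by auto
    interpret pair_graph G using graphs G by blast
    let ?E = "parcs G"
    have fin: "finite (?E `` A)" for A using pair_finite_arcs by (rule finite_Image)
    have sub: "?E `` A \<subseteq> V" for A using in_arcsD2 G by auto
    have irr: "(x, x) \<notin> ?E" for x using no_loops' by blast
    have "V \<noteq> {}" using Suc.prems by auto
    then obtain x where x: "x \<in> V" and
      cases: "card (?E `` {x}) \<le> c \<or> (\<exists>y\<in>V - {x}. card (sym_diff (?E `` {x}) (?E `` {y})) \<le> c)"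
      using reducible[of G] G by auto
    let ?H = "delete_vertex x G"
    have H: "?H \<in> ?C (V - {x})"
    proof -
      have "induced_subgraph (with_proj ?H) (with_proj G)"
        unfolding induced_subgraph_iff by (auto simp: delete_vertex_def)
      then show ?thesis using her G unfolding hereditary_def by (auto simp: delete_vertex_def)
    qed
    \<comment> \<open>Small degree is the case \<open>y = x\<close>, as \<open>x\<close> has no neighbours in \<open>G - x\<close>.\<close>
    obtain y where y: "y \<in> V" "card (sym_diff (?E `` {x}) (parcs ?H `` {y})) \<le> c"
      using cases
    proof
      assume "card (?E `` {x}) \<le> c"
      moreover have "parcs ?H `` {x} = {}" by (auto simp: delete_vertex_def)
      ultimately show thesis using that[of x] x by simp
    next
      assume "\<exists>y\<in>V - {x}. card (sym_diff (?E `` {x}) (?E `` {y})) \<le> c"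
      then obtain y where y: "y \<in> V" "y \<noteq> x" "card (sym_diff (?E `` {x}) (?E `` {y})) \<le> c"
        by blast
      have "parcs ?H `` {y} = ?E `` {y} - {x}" using y G sub by (auto simp: delete_vertex_def)
      then have "sym_diff (?E `` {x}) (parcs ?H `` {y}) \<subseteq>
          sym_diff (?E `` {x}) (?E `` {y})"
        using irr by auto
      from card_mono[OF _ this] show thesis using that[of y] y fin by simp
    qed
    let ?X = "sym_diff (?E `` {x}) (parcs ?H `` {y})"
    have "?X \<in> ?S" using y sub by (auto simp: delete_vertex_def)
    moreover have "sym_diff (parcs ?H `` {y}) ?X = ?E `` {x}" by blast
    ultimately have "G = ?f (x, y, ?X, ?H)" "(x, y, ?X, ?H) \<in> ?D"
      using add_vertex_delete_vertex[of G x] pair_graph x y G H by auto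
    then show "G \<in> ?f ` ?D" by blast
  qed
  then have "finite (?C V)" "card (?C V) \<le> card ?D"
    using \<open>finite ?D\<close> surj_card_le[of ?D "?C V" ?f] by (meson finite_imageI finite_subset)+
  then show ?case using card_D by linarith
qed

lemma at_most_factorialI:
  fixes \<X> :: "nat pair_pre_digraph set"
  assumes her: "hereditary \<X>" and bound: "\<And>n. labelled_count \<X> n \<le> Suc n ^ (d * n)"
  shows "at_most_factorial \<X>"
  unfolding at_most_factorial_def
proof (intro conjI exI allI)
  let ?f = "\<lambda>n. real d * (real n * log 2 (real n + 1))"
  show "?f \<in> O(\<lambda>n. real n * ln (real n))"
    by real_asymp
  fix n
  have "real (labelled_count \<X> n) \<le> real (Suc n ^ (d * n))" using bound of_nat_mono by blast
  also have "\<dots> = (real n + 1) powr real (d * n)"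
    by (subst powr_realpow) (auto simp: add.commute)
  also have "\<dots> = 2 powr ?f n"
    by (simp add: powr_def log_def)
  finally show "real (labelled_count \<X> n) \<le> 2 powr ?f n" .
qed (fact her)

section \<open>The class is at most factorial\<close>

text \<open>
  If all degrees exceed the threshold, the path argument yields two vertices with more than
  \<open>3 * p * (p + 2)\<close> common neighbours, and those yield near twins.
\<close>

lemma small_degree_or_near_twins:
  assumes G: "pair_graph G" "bipartite G" "induced_free (graph_M p) G" "chordality_at_most k G"
    and ne: "pverts G \<noteq> {}"
  defines "c \<equiv> k * (3 * p * (p + 2)) + 1 + 2 * p"
  shows "\<exists>x \<in> pverts G. card (parcs G `` {x}) \<le> c \<or>
    (\<exists>y \<in> pverts G - {x}. card (sym_diff (parcs G `` {x}) (parcs G `` {y})) \<le> c)"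
proof (cases "\<exists>x \<in> pverts G. card (parcs G `` {x}) \<le> k * (3 * p * (p + 2)) + 1")
  case True
  then show ?thesis unfolding c_def by (meson trans_le_add1)
next
  case False
  interpret pair_graph G by (fact G(1))
  let ?E = "parcs G"
  have large: "k * (3 * p * (p + 2)) + 1 < card (?E `` {x})" if "x \<in> pverts G" for x
    using False that by (meson not_le)
  obtain a b where ab: "a \<noteq> b" "3 * p * (p + 2) < card (?E `` {a} \<inter> ?E `` {b})"
    using common_neighbours_if_large_degrees[OF G(1) ne G(4) large] by blast
  have "2 \<le> card (?E `` {x})" if "(x, y) \<in> ?E" for x y
    using large[of x] in_arcsD1[OF that] by linarith
  moreover have "sym ?E" using pair_sym_arcs by (simp add: symmetric_def)
  moreover have "few_missed p ?E" using G by (intro few_missed_if_induced_free_M)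
  ultimately obtain x y where xy: "x \<in> Field ?E" "y \<in> Field ?E" "x \<noteq> y"
      "card (?E `` {x} - ?E `` {y}) \<le> p" "card (?E `` {y} - ?E `` {x}) \<le> p"
    using near_twins_if_many_common_neighbours[OF pair_finite_arcs _ _ ab] by blast
  have "x \<in> pverts G" "y \<in> pverts G" using xy in_arcsD1 in_arcsD2 by (auto simp: Field_def)
  moreover have "card (sym_diff (?E `` {x}) (?E `` {y})) \<le> c"
    using card_Un_le[of "?E `` {x} - ?E `` {y}" "?E `` {y} - ?E `` {x}"] xy unfolding c_def by linarith
  ultimately show ?thesis using xy by blast
qed

theorem theorem7:
  fixes k p :: nat
  shows "at_most_factorial
    {G :: nat pair_pre_digraph.
      pair_graph G \<and> bipartite G \<and> induced_free (graph_M p) G \<and> chordality_at_most k G}"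
    (is "at_most_factorial ?X")
proof (rule at_most_factorialI)
  show "hereditary ?X" by (rule hereditary_bounded_chordality_induced_free)
  fix n
  let ?c = "k * (3 * p * (p + 2)) + 1 + 2 * p"
  have "card {G \<in> ?X. pverts G = {1..n}} \<le> Suc n ^ ((?c + 2) * n)"
  proof (rule card_labelled_le[THEN conjunct2])
    show "hereditary ?X" by (rule hereditary_bounded_chordality_induced_free)
  qed (use small_degree_or_near_twins in auto)
  then show "labelled_count ?X n \<le> Suc n ^ ((?c + 2) * n)"
    unfolding labelled_count_def .
qed

end
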